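(* Let $n$ and $k$ be positive integers with $k < (n+1)/2$. Then the circulant graph $C(n; 1, 2, \ldots, k)$ is $2$-word-representable.
   Context: All graphs are simple and undirected. For a positive integer $n$ and integers $0 < a_1 < a_2 < \cdots < a_k < (n+1)/2$, the circulant graph $C(n; a_1, \ldots, a_k)$ has vertex set $\{0, 1, \ldots, n-1\}$, and two distinct vertices $i, j$ are adjacent if and only if $(i-j) \bmod n$ or $(j-i) \bmod n$ belongs to $\{a_1, \ldots, a_k\}$. Two distinct letters $x, y$ alternate in a word $w$ if, after deleting from $w$ all letters other than $x$ and $y$, one obtains a word $xyxy\cdots$ or $yxyx\cdots$ (of odd or even length). A word $w$ over the alphabet $V$, containing each letter of $V$ at least once, represents a graph $G=(V,E)$ if for all distinct $x,y \in V$: $xy \in E$ if and only if $x$ and $y$ alternate in $w$. A word is $r$-uniform if each letter occurs in it exactly $r$ times. A graph is $r$-word-representable if it is represented by some $r$-uniform word. *)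

theory Defs
  imports Complex_Main
begin

text \<open>An undirected graph is a pair of a vertex set and a set of edges, each edge being an
  unordered pair of distinct vertices.\<close>

type_synonym 'a graph = "'a set \<times> 'a set set"

definition simple_graph :: "'a graph \<Rightarrow> bool" where
  "simple_graph G \<longleftrightarrow>
     finite (fst G) \<and> (\<forall>e \<in> snd G. \<exists>x \<in> fst G. \<exists>y \<in> fst G. x \<noteq> y \<and> e = {x, y})"

text \<open>The set \<open>A\<close> plays the role of the jumps \<open>a\<^sub>1 < ... < a\<^sub>k\<close>, which are understood to
  satisfy \<open>0 < a\<^sub>1\<close> and \<open>a\<^sub>k < (n + 1) / 2\<close>.  The differences are formed in
  the integers, where \<open>mod\<close> by a positive number is nonnegative.\<close>

definition circulant :: "nat \<Rightarrow> nat set \<Rightarrow> nat graph" where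
  "circulant n A =
     ({0..<n},
      {{i, j} | i j. i \<in> {0..<n} \<and> j \<in> {0..<n} \<and> i \<noteq> j \<and>
         ((int i - int j) mod int n \<in> int ` A \<or> (int j - int i) mod int n \<in> int ` A)})"

lemma simple_graph_circulant: "simple_graph (circulant n A)"
  unfolding simple_graph_def circulant_def fst_conv snd_conv
  by (intro conjI ballI) (simp, blast)

text \<open>\<open>alternating_word x y m\<close> is the word \<open>xyxy...\<close> of length \<open>m\<close>.\<close>

definition alternating_word :: "'a \<Rightarrow> 'a \<Rightarrow> nat \<Rightarrow> 'a list" where
  "alternating_word x y m = map (\<lambda>i. if even i then x else y) [0..<m]"

definition alternate :: "'a \<Rightarrow> 'a \<Rightarrow> 'a list \<Rightarrow> bool" where
  "alternate x y w \<longleftrightarrow>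
     (\<exists>m. filter (\<lambda>z. z = x \<or> z = y) w = alternating_word x y m \<or>
          filter (\<lambda>z. z = x \<or> z = y) w = alternating_word y x m)"

definition represents :: "'a list \<Rightarrow> 'a graph \<Rightarrow> bool" where
  "represents w G \<longleftrightarrow>
     set w = fst G \<and>
     (\<forall>x \<in> fst G. \<forall>y \<in> fst G. x \<noteq> y \<longrightarrow> ({x, y} \<in> snd G \<longleftrightarrow> alternate x y w))"

definition uniform_word :: "nat \<Rightarrow> 'a list \<Rightarrow> bool" where
  "uniform_word r w \<longleftrightarrow> (\<forall>x \<in> set w. count_list w x = r)"

definition word_representable :: "nat \<Rightarrow> 'a graph \<Rightarrow> bool" where
  "word_representable r G \<longleftrightarrow> (\<exists>w. uniform_word r w \<and> represents w G)"

end

theory Submission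
  imports Defs
begin

text \<open>A word in which every letter occurs twice is a chord diagram: its positions are points on a
  circle (cut open between the last and the first position), each letter is the chord joining its
  two occurrences, and two letters alternate exactly when their chords cross
  (\<open>alternate_iff_chords_cross\<close>).  So the task is to draw the circulant graph as a
  diagram of crossing chords, for which \<open>word_representable_by_chords\<close> is the criterion.

  Put the \<open>n\<close> vertices on a circle of circumference \<open>n\<close> and let the chord of vertex \<open>x\<close> join
  the points \<open>x\<close> and \<open>x + k + 1/2\<close>.  All chords span arcs of the same length \<open>k + 1/2\<close>.  If this is
  at most half of the circumference, that is \<open>2k < n\<close>, the chords of \<open>x\<close> and \<open>y\<close> cross exactly
  when their initial points are closer than \<open>k + 1/2\<close> on the circle, which is adjacency in
  \<open>C(n; 1, ..., k)\<close>.  Reading the chord ends at the points \<open>0, 1/2, 1, 3/2, ...\<close> in turn gives the word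
  \<open>0, -k, 1, 1 - k, 2, 2 - k, ...\<close> (letters modulo \<open>n\<close>).

  The bound on \<open>k\<close> leaves only the case \<open>2k = n\<close>, where the arcs are too long.  There the graph is
  complete, and the word \<open>0 1 ... (n - 1) 0 1 ... (n - 1)\<close>, in which every chord is a diameter, does it.\<close>

section \<open>Alternation as crossing of chords\<close>

lemma alternating_word_0 [simp]: "alternating_word x y 0 = []"
  by (simp add: alternating_word_def)

lemma alternating_word_Suc: "alternating_word x y (Suc m) = x # alternating_word y x m"
  by (simp add: alternating_word_def map_upt_Suc del: upt_Suc)

lemma distinct_adj_alternating_word:
  assumes "x \<noteq> y"
  shows "distinct_adj (alternating_word x y m)"
  using assms
proof (induction m arbitrary: x y)
  case (Suc m)
  then show ?case
    by (cases m) (auto simp: alternating_word_Suc)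
qed simp

lemma distinct_adj_imp_alternating_word:
  assumes "distinct_adj u" and "set u \<subseteq> {x, y}" and "u = [] \<or> hd u = x"
  shows "u = alternating_word x y (length u)"
  using assms
proof (induction u arbitrary: x y)
  case (Cons a u)
  have "u = alternating_word y x (length u)"
    using Cons.prems by (intro Cons.IH) (cases u; auto)+
  with Cons.prems show ?case
    by (simp add: alternating_word_Suc)
qed simp

text \<open>Over two letters, a word is determined by its first letter once no letter is repeated
  immediately; this replaces the two existential patterns by a local condition.\<close>

lemma alternate_iff_distinct_adj:
  assumes "x \<noteq> y"
  shows "alternate x y w \<longleftrightarrow> distinct_adj (filter (\<lambda>z. z = x \<or> z = y) w)"
    (is "_ \<longleftrightarrow> distinct_adj ?u")
proof
  assume "alternate x y w"
  then show "distinct_adj ?u"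
    using assms by (auto simp: alternate_def distinct_adj_alternating_word)
next
  assume u: "distinct_adj ?u"
  have "set ?u \<subseteq> {x, y}"
    by auto
  moreover from this have "(?u = [] \<or> hd ?u = x) \<or> (?u = [] \<or> hd ?u = y)"
    using hd_in_set[of ?u] by blast
  ultimately show "alternate x y w"
    unfolding alternate_def
    using distinct_adj_imp_alternating_word[OF u, of x y] distinct_adj_imp_alternating_word[OF u, of y x]
    by blast
qed

definition occurrences :: "'a list \<Rightarrow> 'a \<Rightarrow> nat set" where
  "occurrences w x = {p. p < length w \<and> w ! p = x}"

lemma nth_occurrence: "p \<in> occurrences w x \<Longrightarrow> w ! p = x"
  by (simp add: occurrences_def)

lemma filter_eq_map_nth:
  assumes "{p. p < length w \<and> P (w ! p)} = set ps" and "sorted_wrt (<) ps"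
  shows "filter P w = map ((!) w) ps"
proof -
  have "filter (\<lambda>p. P (w ! p)) [0..<length w] = ps"
    using assms
    by (intro sorted_distinct_set_unique) (auto simp: strict_sorted_iff sorted_wrt_filter)
  then have "map ((!) w) ps = filter P (map ((!) w) [0..<length w])"
    by (simp add: filter_map comp_def)
  then show ?thesis
    by (simp add: map_nth)
qed

definition cross :: "nat \<times> nat \<Rightarrow> nat \<times> nat \<Rightarrow> bool" where
  "cross c d \<longleftrightarrow>
     fst c < fst d \<and> fst d < snd c \<and> snd c < snd d \<or>
     fst d < fst c \<and> fst c < snd d \<and> snd d < snd c"

lemma cross_commute: "cross c d \<longleftrightarrow> cross d c"
  by (auto simp: cross_def)

lemma alternate_commute: "alternate x y w \<longleftrightarrow> alternate y x w"
  by (auto simp: alternate_def disj_commute)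

text \<open>Of the three possible orders of the four occurrences that start with \<open>x\<close>, namely
  \<open>xxyy\<close>, \<open>xyyx\<close> and \<open>xyxy\<close>, only the last has no repetition.\<close>

lemma alternate_iff_chords_cross_ordered:
  assumes "x \<noteq> y" and x: "occurrences w x = {a, b}" "a < b"
    and y: "occurrences w y = {c, d}" "c < d" and "a < c"
  shows "alternate x y w \<longleftrightarrow> c < b \<and> b < d"
proof -
  have nth: "w ! a = x" "w ! b = x" "w ! c = y" "w ! d = y"
    using x(1) y(1) by (simp_all add: nth_occurrence)
  have "b \<noteq> c" "b \<noteq> d"
    using nth \<open>x \<noteq> y\<close> by auto
  have "{p. p < length w \<and> (w ! p = x \<or> w ! p = y)} = occurrences w x \<union> occurrences w y"
    by (auto simp: occurrences_def)
  then have occ: "{p. p < length w \<and> (w ! p = x \<or> w ! p = y)} = {a, b, c, d}"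
    using x y by auto
  consider "b < c" | "c < b" "b < d" | "d < b"
    using \<open>b \<noteq> c\<close> \<open>b \<noteq> d\<close> by linarith
  then show ?thesis
  proof cases
    case 1
    have "filter (\<lambda>z. z = x \<or> z = y) w = map ((!) w) [a, b, c, d]"
      using 1 occ x y by (intro filter_eq_map_nth) auto
    then show ?thesis
      using 1 \<open>x \<noteq> y\<close> nth by (simp add: alternate_iff_distinct_adj)
  next
    case 2
    have "filter (\<lambda>z. z = x \<or> z = y) w = map ((!) w) [a, c, b, d]"
      using 2 occ \<open>a < c\<close> by (intro filter_eq_map_nth) auto
    then show ?thesis
      using 2 \<open>x \<noteq> y\<close> nth by (simp add: alternate_iff_distinct_adj)
  next
    case 3
    have "filter (\<lambda>z. z = x \<or> z = y) w = map ((!) w) [a, c, d, b]"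
      using 3 occ \<open>a < c\<close> y by (intro filter_eq_map_nth) auto
    then show ?thesis
      using 3 \<open>x \<noteq> y\<close> nth by (simp add: alternate_iff_distinct_adj)
  qed
qed

lemma alternate_iff_chords_cross:
  assumes "x \<noteq> y" and x: "occurrences w x = {a, b}" "a < b"
    and y: "occurrences w y = {c, d}" "c < d"
  shows "alternate x y w \<longleftrightarrow> cross (a, b) (c, d)"
proof -
  have "a \<noteq> c"
    using nth_occurrence[of a w x] nth_occurrence[of a w y] x(1) y(1) \<open>x \<noteq> y\<close> by auto
  then consider "a < c" | "c < a"
    by linarith
  then show ?thesis
  proof cases
    case 1
    then show ?thesis
      using alternate_iff_chords_cross_ordered[OF assms] by (auto simp: cross_def)
  next
    case 2
    then show ?thesis
      using alternate_iff_chords_cross_ordered[OF \<open>x \<noteq> y\<close>[symmetric] y x] alternate_commute[of x y w]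
      by (auto simp: cross_def)
  qed
qed

lemma count_list_eq_card_occurrences: "count_list w x = card (occurrences w x)"
  by (simp add: count_list_eq_length_filter length_filter_conv_card occurrences_def eq_commute)

text \<open>Crossing and adjacency are both symmetric, so for vertices that are linearly ordered they
  need to be compared for one order of each pair only.\<close>

lemma word_representable_by_chords:
  fixes G :: "'a::linorder graph" and l r :: "'a \<Rightarrow> nat"
  assumes set_w: "set w = fst G"
    and occ: "\<And>x. x \<in> fst G \<Longrightarrow> occurrences w x = {l x, r x}"
    and lr: "\<And>x. x \<in> fst G \<Longrightarrow> l x < r x"
    and edge: "\<And>x y. \<lbrakk>x \<in> fst G; y \<in> fst G; x < y\<rbrakk> \<Longrightarrow>
                 {x, y} \<in> snd G \<longleftrightarrow> cross (l x, r x) (l y, r y)"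
  shows "word_representable 2 G"
proof -
  have "count_list w x = 2" if "x \<in> set w" for x
  proof -
    have "l x \<noteq> r x"
      using lr[of x] that set_w by simp
    then show ?thesis
      using occ[of x] that set_w by (simp add: count_list_eq_card_occurrences)
  qed
  then have "uniform_word 2 w"
    by (simp add: uniform_word_def)
  moreover have "{x, y} \<in> snd G \<longleftrightarrow> alternate x y w"
    if "x \<in> fst G" "y \<in> fst G" "x \<noteq> y" for x y
  proof -
    have "{x, y} \<in> snd G \<longleftrightarrow> cross (l x, r x) (l y, r y)"
      using edge[of x y] edge[of y x] that
      by (metis cross_commute insert_commute linorder_less_linear)
    also have "\<dots> \<longleftrightarrow> alternate x y w"
      using alternate_iff_chords_cross[of x y w "l x" "r x" "l y" "r y"] occ lr that by simp
    finally show ?thesis .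
  qed
  ultimately show ?thesis
    using set_w unfolding word_representable_def represents_def by blast
qed

section \<open>Chord diagrams for circulant graphs\<close>

lemma circulant_edge_iff:
  assumes "x < y" and "y < n"
  shows "{x, y} \<in> snd (circulant n {1..k}) \<longleftrightarrow> y - x \<le> k \<or> n \<le> k + (y - x)"
proof -
  have forward: "(int y - int x) mod int n = int (y - x)"
    using assms by (simp add: of_nat_diff)
  have "(int x - int y) mod int n = (int x - int y + int n) mod int n"
    by simp
  also have "\<dots> = int (n - (y - x))"
    using assms by (subst mod_pos_pos_trivial) (auto simp: of_nat_diff)
  finally have backward: "(int x - int y) mod int n = int (n - (y - x))" .
  have "{x, y} \<in> snd (circulant n {1..k}) \<longleftrightarrow>
    (int x - int y) mod int n \<in> int ` {1..k} \<or> (int y - int x) mod int n \<in> int ` {1..k}"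
    unfolding circulant_def snd_conv mem_Collect_eq
    using assms by (intro iffI exI[of _ x] exI[of _ y]) (auto simp: doubleton_eq_iff)
  also have "\<dots> \<longleftrightarrow> n - (y - x) \<in> {1..k} \<or> y - x \<in> {1..k}"
    unfolding forward backward by (simp only: inj_image_mem_iff[OF inj_of_nat])
  also have "\<dots> \<longleftrightarrow> y - x \<le> k \<or> n \<le> k + (y - x)"
    using assms by auto
  finally show ?thesis .
qed

text \<open>Position \<open>2p\<close> stands for the point \<open>p\<close> of the circle and position \<open>2p + 1\<close> for the point
  \<open>p + 1/2\<close>, where the chord of the vertex \<open>p - k\<close> ends; \<open>n - k\<close> stands for \<open>- k\<close> modulo \<open>n\<close>.\<close>

definition arc_word :: "nat \<Rightarrow> nat \<Rightarrow> nat list" where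
  "arc_word n k = map (\<lambda>p. if even p then p div 2 else (p div 2 + (n - k)) mod n) [0..<2 * n]"

lemma shift_mod_eq_iff:
  fixes n k p x :: nat
  assumes "k \<le> n" and "p < n" and "x < n"
  shows "(p + (n - k)) mod n = x \<longleftrightarrow> p = (x + k) mod n"
proof
  assume "(p + (n - k)) mod n = x"
  then have "(x + k) mod n = (p + (n - k) + k) mod n"
    by (metis mod_add_left_eq)
  then show "p = (x + k) mod n"
    using assms by simp
next
  assume "p = (x + k) mod n"
  then have "(p + (n - k)) mod n = (x + k + (n - k)) mod n"
    by (metis mod_add_left_eq)
  then show "(p + (n - k)) mod n = x"
    using assms by simp
qed

lemma occurrences_arc_word:
  assumes "k \<le> n" and "x < n"
  shows "occurrences (arc_word n k) x = {2 * x, 2 * ((x + k) mod n) + 1}"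
proof (intro set_eqI)
  fix p
  show "p \<in> occurrences (arc_word n k) x \<longleftrightarrow> p \<in> {2 * x, 2 * ((x + k) mod n) + 1}"
  proof (cases "even p")
    case True
    then show ?thesis
      using assms by (auto simp: occurrences_def arc_word_def)
  next
    case False
    then obtain q where q: "p = 2 * q + 1"
      by (rule oddE)
    have "p \<in> occurrences (arc_word n k) x \<longleftrightarrow> q < n \<and> (q + (n - k)) mod n = x"
      by (auto simp: occurrences_def arc_word_def q)
    also have "\<dots> \<longleftrightarrow> q = (x + k) mod n"
      using assms shift_mod_eq_iff[of k n q x] mod_less_divisor[of n "x + k"] by auto
    also have "\<dots> \<longleftrightarrow> p \<in> {2 * x, 2 * ((x + k) mod n) + 1}"
    proof -
      have "p \<noteq> 2 * x"
        using \<open>odd p\<close> by auto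
      then show ?thesis
        by (auto simp: q)
    qed
    finally show ?thesis .
  qed
qed

lemma set_arc_word:
  assumes "k \<le> n"
  shows "set (arc_word n k) = {0..<n}"
proof
  show "set (arc_word n k) \<subseteq> {0..<n}"
    by (auto simp: arc_word_def)
  have "x \<in> set (arc_word n k)" if "x < n" for x
  proof -
    have "2 * x \<in> occurrences (arc_word n k) x"
      using occurrences_arc_word[OF assms that] by simp
    then show ?thesis
      by (auto simp: occurrences_def in_set_conv_nth)
  qed
  then show "{0..<n} \<subseteq> set (arc_word n k)"
    by auto
qed

lemma circulant_word_representable_short_arcs:
  assumes "2 * k < n"
  shows "word_representable 2 (circulant n {1..k})"
proof -
  define s t where "s x = 2 * x" and "t x = 2 * ((x + k) mod n) + 1" for x :: nat
  have end_cases: "t x = (if x + k < n then 2 * (x + k) + 1 else 2 * (x + k - n) + 1)"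
    if "x < n" for x
    using that assms by (simp add: t_def le_mod_geq)
  show ?thesis
  proof (rule word_representable_by_chords[where w = "arc_word n k"
        and l = "\<lambda>x. min (s x) (t x)" and r = "\<lambda>x. max (s x) (t x)"])
    show "set (arc_word n k) = fst (circulant n {1..k})"
      using assms by (simp add: set_arc_word circulant_def)
  next
    fix x
    assume "x \<in> fst (circulant n {1..k})"
    then have "x < n"
      by (simp add: circulant_def)
    then show "occurrences (arc_word n k) x = {min (s x) (t x), max (s x) (t x)}"
      using assms occurrences_arc_word[of k n x] by (auto simp: s_def t_def min_def max_def)
    have "even (s x)" and "odd (t x)"
      by (simp_all add: s_def t_def)
    then have "s x \<noteq> t x"
      by auto
    then show "min (s x) (t x) < max (s x) (t x)"
      by auto
  next
    fix x y
    assume "x \<in> fst (circulant n {1..k})" "y \<in> fst (circulant n {1..k})" and "x < y"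
    then have "x < n" "y < n"
      by (simp_all add: circulant_def)
    \<comment> \<open>An arc passes the cut of the circle iff \<open>n \<le> x + k\<close>; in that case its end precedes its start.\<close>
    consider "y + k < n" | "x + k < n" "n \<le> y + k" | "n \<le> x + k"
      by linarith
    then have "cross (min (s x) (t x), max (s x) (t x)) (min (s y) (t y), max (s y) (t y)) \<longleftrightarrow>
        y - x \<le> k \<or> n \<le> k + (y - x)"
    proof cases
      case 1
      then show ?thesis
        using \<open>x < y\<close> \<open>x < n\<close> \<open>y < n\<close> assms by (auto simp: cross_def end_cases s_def)
    next
      case 2
      define d e where "d = y - x" and "e = y + k - n"
      have d: "y = x + d" and e: "x + d + k = n + e"
        using 2 \<open>x < y\<close> by (simp_all add: d_def e_def)
      have "min (s x) (t x) = 2 * x" "max (s x) (t x) = 2 * (x + k) + 1"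
        "min (s y) (t y) = 2 * e + 1" "max (s y) (t y) = 2 * y"
        using 2 \<open>x < n\<close> \<open>y < n\<close> assms by (auto simp: end_cases s_def e_def)
      then have "cross (min (s x) (t x), max (s x) (t x)) (min (s y) (t y), max (s y) (t y)) \<longleftrightarrow>
          x \<le> e \<and> e < x + k \<and> x + k < y \<or> e < x \<and> x < y \<and> y \<le> x + k"
        by (simp add: cross_def) linarith
      also have "\<dots> \<longleftrightarrow> n \<le> k + d \<and> k < d \<or> k + d < n \<and> d \<le> k"
        using d e \<open>x < y\<close> \<open>y < n\<close> by (intro iffI; linarith)
      \<comment> \<open>The two arcs between \<open>x\<close> and \<open>y\<close> have total length \<open>n > 2k\<close>, so not both are of length at most \<open>k\<close>.\<close>
      also have "\<dots> \<longleftrightarrow> d \<le> k \<or> n \<le> k + d"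
        using assms by linarith
      finally show ?thesis
        by (simp add: d_def)
    next
      \<comment> \<open>Both starts lie among the last \<open>k\<close> vertices and both ends among the points before them,
        so the chords cross and the vertices are adjacent.\<close>
      case 3
      then have "min (s x) (t x) = 2 * (x + k - n) + 1" "max (s x) (t x) = 2 * x"
        "min (s y) (t y) = 2 * (y + k - n) + 1" "max (s y) (t y) = 2 * y"
        using \<open>x < y\<close> \<open>x < n\<close> \<open>y < n\<close> assms by (auto simp: end_cases s_def)
      moreover have "x + k - n < y + k - n" "y + k - n < x" "y - x \<le> k"
        using 3 \<open>x < y\<close> \<open>y < n\<close> assms by linarith+
      ultimately show ?thesis
        using \<open>x < y\<close> by (simp add: cross_def)
    qed
    then show "{x, y} \<in> snd (circulant n {1..k}) \<longleftrightarrow>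
        cross (min (s x) (t x), max (s x) (t x)) (min (s y) (t y), max (s y) (t y))"
      using circulant_edge_iff[OF \<open>x < y\<close> \<open>y < n\<close>] by simp
  qed
qed

text \<open>Two distinct points on a circle of circumference \<open>n \<le> 2k\<close> are within distance \<open>k\<close> of each
  other, and any two diameters cross.\<close>

lemma circulant_word_representable_complete:
  assumes "n \<le> 2 * k"
  shows "word_representable 2 (circulant n {1..k})"
proof (rule word_representable_by_chords[where w = "[0..<n] @ [0..<n]"
      and l = "\<lambda>x. x" and r = "\<lambda>x. x + n"])
  show "set ([0..<n] @ [0..<n]) = fst (circulant n {1..k})"
    by (simp add: circulant_def)
next
  fix x
  assume "x \<in> fst (circulant n {1..k})"
  then have "x < n"
    by (simp add: circulant_def)
  then show "occurrences ([0..<n] @ [0..<n]) x = {x, x + n}"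
    by (auto simp: occurrences_def nth_append split: if_splits)
  show "x < x + n"
    using \<open>x < n\<close> by simp
next
  fix x y
  assume "x \<in> fst (circulant n {1..k})" "y \<in> fst (circulant n {1..k})" and "x < y"
  then have "y < n"
    by (simp add: circulant_def)
  then show "{x, y} \<in> snd (circulant n {1..k}) \<longleftrightarrow> cross (x, x + n) (y, y + n)"
    unfolding circulant_edge_iff[OF \<open>x < y\<close> \<open>y < n\<close>]
    using assms \<open>x < y\<close> by (auto simp: cross_def)
qed

theorem theorem3p1:
  fixes n k :: nat
  assumes "n > 0" and "k > 0" and "real k < (real n + 1) / 2"
  shows "word_representable 2 (circulant n {1..k})"
proof (cases "2 * k < n")
  case True
  then show ?thesis
    by (rule circulant_word_representable_short_arcs)
next
  case False
  then show ?thesis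
    by (intro circulant_word_representable_complete) simp
qed

end
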